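(* Let $A\in\mathbb{R}^{n\times n}$ be a symmetric positive definite matrix, let $B\in\mathbb{R}^{m\times n}$ and $C\in\mathbb{R}^{p\times m}$ be full row rank matrices, and let $s>0$. Then the PESS iterative process ${\bf u}_{k+1}=\mathcal{T}{\bf u}_k+{\bf c}$ converges to the unique solution of the three-by-three block saddle point problem $\mathcal{A}{\bf u}={\bf d}$ if and only if $$(2s-1)|\mu|^2+2\,\Re(\mu)>0\quad\text{for all }\mu\in\sigma\big(\Sigma^{-\frac12}\mathcal{A}\Sigma^{-\frac12}\big).$$
   Context: The saddle point matrix is $\mathcal{A}=\begin{bmatrix}A&B^T&0\\-B&0&-C^T\\0&C&0\end{bmatrix}\in\mathbb{R}^{(n+m+p)\times(n+m+p)}$ and ${\bf d}\in\mathbb{R}^{n+m+p}$ is a given vector. $\Lambda_1\in\mathbb{R}^{n\times n}$, $\Lambda_2\in\mathbb{R}^{m\times m}$, $\Lambda_3\in\mathbb{R}^{p\times p}$ are fixed symmetric positive definite matrices and $\Sigma=\mathrm{diag}(\Lambda_1,\Lambda_2,\Lambda_3)$ (block diagonal). For $s>0$ put $\mathcal{P}_{PESS}=\Sigma+s\mathcal{A}$ (which is nonsingular) and $\mathcal{Q}_{PESS}=\Sigma-(1-s)\mathcal{A}$, so $\mathcal{A}=\mathcal{P}_{PESS}-\mathcal{Q}_{PESS}$. The PESS iterative process, for an initial guess ${\bf u}_0\in\mathbb{R}^{n+m+p}$, is ${\bf u}_{k+1}=\mathcal{T}{\bf u}_k+{\bf c}$, $k=0,1,2,\ldots$, with $\mathcal{T}=\mathcal{P}_{PESS}^{-1}\mathcal{Q}_{PESS}$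 and ${\bf c}=\mathcal{P}_{PESS}^{-1}{\bf d}$. Convergence of the process means convergence for every initial guess ${\bf u}_0$. $\sigma(\cdot)$ denotes the spectrum (over $\mathbb{C}$). *)

theory Defs
  imports "HOL-Analysis.Analysis"
begin

text \<open>A \<open>p \<times> q\<close> matrix has type \<open>real ^ 'q ^ 'p\<close>. Block vectors and matrices are indexed by the
  sum type \<open>'n + 'm + 'p\<close>, parsed as \<open>'n + ('m + 'p)\<close>: the three blocks are
  \<open>Inl i\<close>, \<open>Inr (Inl i)\<close> and \<open>Inr (Inr i)\<close>.\<close>

definition block3 ::
  "real^'n^'n \<Rightarrow> real^'m^'n \<Rightarrow> real^'p^'n \<Rightarrow>
   real^'n^'m \<Rightarrow> real^'m^'m \<Rightarrow> real^'p^'m \<Rightarrow>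
   real^'n^'p \<Rightarrow> real^'m^'p \<Rightarrow> real^'p^'p \<Rightarrow>
   real^('n + 'm + 'p)^('n + 'm + 'p)" where
  "block3 M11 M12 M13 M21 M22 M23 M31 M32 M33 = (\<chi> i j.
     (case i of
        Inl a \<Rightarrow> (case j of Inl b \<Rightarrow> M11 $ a $ b
                 | Inr (Inl b) \<Rightarrow> M12 $ a $ b
                 | Inr (Inr b) \<Rightarrow> M13 $ a $ b)
      | Inr (Inl a) \<Rightarrow> (case j of Inl b \<Rightarrow> M21 $ a $ b
                 | Inr (Inl b) \<Rightarrow> M22 $ a $ b
                 | Inr (Inr b) \<Rightarrow> M23 $ a $ b)
      | Inr (Inr a) \<Rightarrow> (case j of Inl b \<Rightarrow> M31 $ a $ b
                 | Inr (Inl b) \<Rightarrow> M32 $ a $ b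
                 | Inr (Inr b) \<Rightarrow> M33 $ a $ b)))"

definition saddle_matrix ::
  "real^'n^'n \<Rightarrow> real^'n^'m \<Rightarrow> real^'m^'p \<Rightarrow> real^('n + 'm + 'p)^('n + 'm + 'p)" where
  "saddle_matrix A B C =
     block3 A   (transpose B) 0
            (-B) 0            (- transpose C)
            0   C             0"

definition Sigma_matrix ::
  "real^'n^'n \<Rightarrow> real^'m^'m \<Rightarrow> real^'p^'p \<Rightarrow> real^('n + 'm + 'p)^('n + 'm + 'p)" where
  "Sigma_matrix L1 L2 L3 =
     block3 L1 0  0
            0  L2 0
            0  0  L3"

definition sym_pos_def :: "real^'n^'n \<Rightarrow> bool" where
  "sym_pos_def M \<longleftrightarrow> transpose M = M \<and> (\<forall>x. x \<noteq> 0 \<longrightarrow> x \<bullet> (M *v x) > 0)"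

definition full_row_rank :: "real^'n^'m \<Rightarrow> bool" where
  "full_row_rank M \<longleftrightarrow> rank M = CARD('m)"

text \<open>The principal square root. Only meaningful for symmetric positive definite \<open>M\<close>, where a
  symmetric positive definite square root exists and is unique.\<close>

definition spd_sqrt :: "real^'n^'n \<Rightarrow> real^'n^'n" where
  "spd_sqrt M = (THE R. sym_pos_def R \<and> R ** R = M)"

definition spd_inv_sqrt :: "real^'n^'n \<Rightarrow> real^'n^'n" where
  "spd_inv_sqrt M = matrix_inv (spd_sqrt M)"

definition spectrum :: "real^'n^'n \<Rightarrow> complex set" where
  "spectrum M = {\<mu>. \<exists>v :: complex^'n. v \<noteq> 0 \<and> map_matrix complex_of_real M *v v = \<mu> *s v}"

definition P_PESS :: "real^'k^'k \<Rightarrow> real^'k^'k \<Rightarrow> real \<Rightarrow> real^'k^'k" where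
  "P_PESS \<Sigma> \<A> s = \<Sigma> + s *\<^sub>R \<A>"

definition Q_PESS :: "real^'k^'k \<Rightarrow> real^'k^'k \<Rightarrow> real \<Rightarrow> real^'k^'k" where
  "Q_PESS \<Sigma> \<A> s = \<Sigma> - (1 - s) *\<^sub>R \<A>"

definition T_PESS :: "real^'k^'k \<Rightarrow> real^'k^'k \<Rightarrow> real \<Rightarrow> real^'k^'k" where
  "T_PESS \<Sigma> \<A> s = matrix_inv (P_PESS \<Sigma> \<A> s) ** Q_PESS \<Sigma> \<A> s"

definition c_PESS :: "real^'k^'k \<Rightarrow> real^'k^'k \<Rightarrow> real \<Rightarrow> real^'k \<Rightarrow> real^'k" where
  "c_PESS \<Sigma> \<A> s d = matrix_inv (P_PESS \<Sigma> \<A> s) *v d"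

primrec PESS_iter ::
  "real^'k^'k \<Rightarrow> real^'k^'k \<Rightarrow> real \<Rightarrow> real^'k \<Rightarrow> real^'k \<Rightarrow> nat \<Rightarrow> real^'k" where
  "PESS_iter \<Sigma> \<A> s d u0 0 = u0"
| "PESS_iter \<Sigma> \<A> s d u0 (Suc k) = T_PESS \<Sigma> \<A> s *v PESS_iter \<Sigma> \<A> s d u0 k + c_PESS \<Sigma> \<A> s d"

end

theory Submission
  imports Defs "HOL-Computational_Algebra.Fundamental_Theorem_Algebra"
begin

text \<open>The error of the iteration is multiplied by \<open>T = P\<inverse> Q\<close> in each step, so the process converges
  for every start iff the powers of \<open>T\<close> tend to zero pointwise, which means that all eigenvalues of
  \<open>T\<close> lie in the open unit disc. For the harder implication, every \<open>u\<close> is annihilated by some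
  \<open>p(T)\<close> with \<open>p\<close> split over the complex numbers. Peel off one factor \<open>T - l\<close> at a time: if \<open>l\<close> is an
  eigenvalue, then \<open>|l| < 1\<close> and the orbit of \<open>u\<close> obeys a contracting recursion; otherwise \<open>T - l\<close>
  is invertible and commutes with \<open>T\<close>.

  The eigenvalues \<open>l\<close> of \<open>T\<close> and \<open>\<mu>\<close> of \<open>spd_inv_sqrt \<Sigma> ** \<A> ** spd_inv_sqrt \<Sigma>\<close> both come from the pencil
  \<open>\<A> w = \<mu> \<Sigma> w\<close>, with \<open>l = (1 - (1 - s) \<mu>) / (1 + s \<mu>)\<close>, and \<open>|l| < 1\<close> expands to the
  stated inequality.\<close>

section \<open>Square roots of positive definite matrices\<close>

lemma inner_matrix_vector_mult: "x \<bullet> (M *v y) = (transpose M *v x) \<bullet> y"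
  for M :: "real^'n^'m"
  by (simp add: dot_lmul_matrix)

lemma self_adjoint_matrix: "transpose M = M \<Longrightarrow> x \<bullet> (M *v y) = (M *v x) \<bullet> y"
  for M :: "real^'n^'n"
  by (simp add: inner_matrix_vector_mult)

text \<open>A maximiser of the Rayleigh quotient is an eigenvector.\<close>

lemma symmetric_matrix_eigenvector:
  fixes M :: "real^'n^'n"
  assumes sym: "transpose M = M" and W: "subspace W" and inv: "\<And>x. x \<in> W \<Longrightarrow> M *v x \<in> W"
    and nz: "x0 \<in> W" "x0 \<noteq> 0"
  obtains x l where "x \<in> W" "norm x = 1" "M *v x = l *\<^sub>R x"
proof -
  have "compact (W \<inter> sphere 0 1)"
    by (simp add: W closed_Int_compact closed_subspace)
  moreover have "(1 / norm x0) *\<^sub>R x0 \<in> W \<inter> sphere 0 1"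
    using nz W by (simp add: subspace_scale)
  moreover have "continuous_on (W \<inter> sphere 0 1) (\<lambda>x. x \<bullet> (M *v x))"
    by (intro continuous_intros)
  ultimately obtain x where x: "x \<in> W" "norm x = 1"
    and max: "\<And>y. y \<in> W \<Longrightarrow> norm y = 1 \<Longrightarrow> y \<bullet> (M *v y) \<le> x \<bullet> (M *v x)"
    using continuous_attains_sup[of "W \<inter> sphere 0 1" "\<lambda>x. x \<bullet> (M *v x)"]
    by (metis (no_types, lifting) Int_iff empty_iff mem_sphere_0)
  define l where "l = x \<bullet> (M *v x)"
  have xx: "x \<bullet> x = 1" using x by (simp add: dot_square_norm)
  have le: "y \<bullet> (M *v y) \<le> l * (y \<bullet> y)" if "y \<in> W" for y
  proof (cases "y = 0")
    case False
    have "(1 / norm y) *\<^sub>R y \<bullet> (M *v ((1 / norm y) *\<^sub>R y)) \<le> l"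
      unfolding l_def by (rule max) (use that W False in \<open>simp_all add: subspace_scale\<close>)
    then have "(y \<bullet> (M *v y)) / (norm y)\<^sup>2 \<le> l"
      by (simp add: scaleR_matrix_vector_assoc[symmetric] matrix_vector_mult_scaleR power2_eq_square)
    then show ?thesis
      using False by (simp add: divide_le_eq dot_square_norm)
  qed simp
  \<comment> \<open>The residual \<open>z\<close> is the direction in which \<open>x\<close> is
    perturbed. By maximality the quadratic in \<open>t\<close> in \<open>key\<close> is nonnegative,
    but its linear coefficient is \<open>2 * (z \<bullet> z)\<close>, so a small negative
    \<open>t\<close> refutes \<open>z \<noteq> 0\<close>.\<close>
  define z where "z = l *\<^sub>R x - M *v x"
  have zW: "z \<in> W" unfolding z_def using W x inv by (simp add: subspace_diff subspace_scale)
  have key: "0 \<le> 2 * t * (z \<bullet> z) + t\<^sup>2 * (l * (z \<bullet> z) - z \<bullet> (M *v z))" for t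
  proof -
    have "x + t *\<^sub>R z \<in> W" using W x zW by (simp add: subspace_add subspace_scale)
    from le[OF this]
    have "0 \<le> l * ((x + t *\<^sub>R z) \<bullet> (x + t *\<^sub>R z)) - (x + t *\<^sub>R z) \<bullet> (M *v (x + t *\<^sub>R z))" by simp
    also have "\<dots> = l * (x \<bullet> x) - x \<bullet> (M *v x) + 2 * t * (l * (z \<bullet> x) - z \<bullet> (M *v x))
        + t\<^sup>2 * (l * (z \<bullet> z) - z \<bullet> (M *v z))"
      using self_adjoint_matrix[OF sym, of x z]
      by (simp add: algebra_simps inner_simps inner_commute matrix_vector_right_distrib
          matrix_vector_mult_scaleR power2_eq_square)
    also have "l * (x \<bullet> x) - x \<bullet> (M *v x) = 0" using xx l_def by simp
    also have "l * (z \<bullet> x) - z \<bullet> (M *v x) = z \<bullet> z"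
      by (simp add: z_def inner_simps)
    finally show ?thesis by simp
  qed
  have "z \<bullet> z = 0"
  proof (rule ccontr)
    assume "z \<bullet> z \<noteq> 0"
    then have a: "z \<bullet> z > 0" by simp
    define b where "b = l * (z \<bullet> z) - z \<bullet> (M *v z)"
    \<comment> \<open>Dividing by \<open>\<bar>b\<bar> + 1\<close> keeps
      \<open>\<bar>t * b\<bar>\<close> at most \<open>z \<bullet> z\<close>, so the quadratic term
      cannot outweigh the linear one; the \<open>+ 1\<close> covers \<open>b = 0\<close>.\<close>
    define t where "t = - (z \<bullet> z) / (\<bar>b\<bar> + 1)"
    have t: "t < 0" using a by (simp add: t_def divide_neg_pos)
    have "0 \<le> t * (2 * (z \<bullet> z) + t * b)"
      using key[of t] by (simp add: b_def algebra_simps power2_eq_square)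
    then have "2 * (z \<bullet> z) + t * b \<le> 0" using t by (simp add: zero_le_mult_iff)
    moreover have "\<bar>t * b\<bar> \<le> z \<bullet> z"
      using a by (simp add: t_def abs_mult divide_le_eq mult_left_mono)
    ultimately show False using a by linarith
  qed
  then have "M *v x = l *\<^sub>R x" by (simp add: z_def)
  with x that show thesis by blast
qed

text \<open>An orthonormal family of eigenvectors of maximal size must span: its orthogonal
  complement is invariant because \<open>M\<close> is symmetric, so a nonzero complement would
  contain one more unit eigenvector.\<close>

lemma symmetric_matrix_eigenbasis:
  fixes M :: "real^'n^'n"
  assumes sym: "transpose M = M"
  obtains B where "finite B" "span B = UNIV" "pairwise orthogonal B" "\<And>b. b \<in> B \<Longrightarrow> norm b = 1"
    "\<And>b. b \<in> B \<Longrightarrow> M *v b = (b \<bullet> (M *v b)) *\<^sub>R b"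
proof -
  define E where "E B \<longleftrightarrow> pairwise orthogonal B \<and> (\<forall>b\<in>B. norm b = 1 \<and> M *v b = (b \<bullet> (M *v b)) *\<^sub>R b)"
    for B
  have bound: "finite B \<and> card B \<le> DIM(real^'n)" if "E B" for B
  proof -
    have "0 \<notin> B" using that unfolding E_def by force
    then show ?thesis using that pairwise_orthogonal_independent independent_bound unfolding E_def by blast
  qed
  have "E {}" by (simp add: E_def)
  then obtain B where B: "E B" and max: "\<And>B'. E B' \<Longrightarrow> card B' \<le> card B"
    using ex_has_greatest_nat[of E "{}" card "Suc DIM(real^'n)"] bound by (metis less_Suc_eq_le)
  have "span B = UNIV"
  proof (rule ccontr)
    assume "span B \<noteq> UNIV"
    then obtain x where x: "x \<noteq> 0" "\<And>y. y \<in> span B \<Longrightarrow> orthogonal x y"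
      using orthogonal_to_subspace_exists_gen[of B UNIV] by (metis span_UNIV top.not_eq_extremum)
    define W where "W = {y. \<forall>b\<in>B. orthogonal b y}"
    have "subspace W" unfolding W_def by (rule subspace_orthogonal_to_vectors)
    moreover have "M *v y \<in> W" if "y \<in> W" for y
      unfolding W_def
    proof (clarify)
      fix b assume b: "b \<in> B"
      have "b \<bullet> (M *v y) = (b \<bullet> (M *v b)) * (b \<bullet> y)"
        using B b unfolding E_def self_adjoint_matrix[OF sym, of b y] by (metis inner_scaleR_left)
      then show "orthogonal b (M *v y)" using that b by (simp add: W_def orthogonal_def)
    qed
    moreover have "x \<in> W" unfolding W_def using x by (simp add: orthogonal_commute span_base)
    ultimately obtain e l where e: "e \<in> W" "norm e = 1" "M *v e = l *\<^sub>R e"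
      using symmetric_matrix_eigenvector[OF sym] x(1) by metis
    have "e \<bullet> (M *v e) = l" using e by (simp add: dot_square_norm)
    then have "E (insert e B)"
      using B e unfolding E_def W_def pairwise_insert by (auto simp: orthogonal_commute)
    moreover have "e \<notin> B" using e by (auto simp: W_def orthogonal_def)
    ultimately show False using max[of "insert e B"] bound[OF B] by simp
  qed
  then show thesis using that bound[OF B] B unfolding E_def by blast
qed

text \<open>The remainder is orthogonal to every basis vector, hence to the whole span, hence to
  itself.\<close>

lemma orthonormal_expansion:
  fixes B :: "'a::euclidean_space set"
  assumes "finite B" "span B = UNIV" "pairwise orthogonal B" "\<And>b. b \<in> B \<Longrightarrow> norm b = 1"
  shows "(\<Sum>b\<in>B. (b \<bullet> x) *\<^sub>R b) = x"
proof -
  define y where "y = x - (\<Sum>b\<in>B. (b \<bullet> x) *\<^sub>R b)"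
  have "orthogonal y c" if c: "c \<in> B" for c
  proof -
    have "(\<Sum>b\<in>B. (b \<bullet> x) * (b \<bullet> c)) = (\<Sum>b\<in>B. if b = c then c \<bullet> x else 0)"
      using assms c by (intro sum.cong) (auto simp: pairwise_def orthogonal_def dot_square_norm)
    moreover have "y \<bullet> c = c \<bullet> x - (\<Sum>b\<in>B. (b \<bullet> x) * (b \<bullet> c))"
      by (simp add: y_def inner_diff_left inner_sum_left inner_commute[of c x])
    ultimately show ?thesis
      using c assms(1) by (simp add: orthogonal_def)
  qed
  then have "orthogonal y y" using orthogonal_to_span assms(2) by blast
  then show ?thesis by (simp add: y_def orthogonal_def)
qed

text \<open>The symmetric matrix \<open>D = R - S\<close> satisfies \<open>R D + D S = 0\<close>, so an eigenvector \<open>b\<close> of \<open>D\<close> with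
  eigenvalue \<open>l\<close> gives \<open>l (b \<bullet> R b + b \<bullet> S b) = 0\<close>.\<close>

lemma sym_pos_def_sqrt_unique:
  fixes R S :: "real^'n^'n"
  assumes R: "sym_pos_def R" and S: "sym_pos_def S" and eq: "R ** R = S ** S"
  shows "R = S"
proof -
  define D where "D = R - S"
  have "transpose D = D" using R S unfolding sym_pos_def_def D_def
    by (simp add: transpose_def vec_eq_iff)
  then obtain B where B: "finite B" "span B = UNIV" "pairwise orthogonal B" "\<And>b. b \<in> B \<Longrightarrow> norm b = 1"
    "\<And>b. b \<in> B \<Longrightarrow> D *v b = (b \<bullet> (D *v b)) *\<^sub>R b" using symmetric_matrix_eigenbasis by blast
  have sylvester: "R *v (D *v x) + D *v (S *v x) = 0" for x
  proof -
    have "R *v (R *v x) = S *v (S *v x)" using eq by (simp add: matrix_vector_mul_assoc)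
    then show ?thesis by (simp add: D_def matrix_vector_mult_diff_rdistrib matrix_vector_mult_diff_distrib)
  qed
  have zero: "D *v b = 0" if b: "b \<in> B" for b
  proof -
    define l where "l = b \<bullet> (D *v b)"
    have l: "D *v b = l *\<^sub>R b" using B(5)[OF b] by (simp add: l_def)
    have "0 = b \<bullet> (R *v (D *v b) + D *v (S *v b))" by (simp add: sylvester)
    also have "\<dots> = b \<bullet> (R *v (D *v b)) + (D *v b) \<bullet> (S *v b)"
      by (simp add: inner_simps self_adjoint_matrix[OF \<open>transpose D = D\<close>])
    also have "\<dots> = l * (b \<bullet> (R *v b) + b \<bullet> (S *v b))"
      by (simp add: l matrix_vector_mult_scaleR algebra_simps)
    finally have "l * (b \<bullet> (R *v b) + b \<bullet> (S *v b)) = 0" by simp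
    moreover have "b \<noteq> 0" using B(4)[OF b] by auto
    then have "b \<bullet> (R *v b) + b \<bullet> (S *v b) > 0" using R S by (simp add: sym_pos_def_def add_pos_pos)
    ultimately show ?thesis using l by simp
  qed
  have "D *v x = 0" for x
  proof -
    have "D *v x = D *v (\<Sum>b\<in>B. (b \<bullet> x) *\<^sub>R b)" using orthonormal_expansion[OF B(1-4)] by simp
    also have "\<dots> = (\<Sum>b\<in>B. (b \<bullet> x) *\<^sub>R (D *v b))"
      by (simp add: linear_sum[OF matrix_vector_mul_linear] matrix_vector_mult_scaleR)
    finally show ?thesis using zero by simp
  qed
  then have "R *v x = S *v x" for x by (metis D_def eq_iff_diff_eq_0 matrix_vector_mult_diff_rdistrib)
  then show ?thesis by (simp add: matrix_eq)
qed

text \<open>On an orthonormal eigenbasis of \<open>M\<close> the root acts by the square roots of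
  the eigenvalues, which are positive since \<open>M\<close> is positive definite.\<close>

lemma sym_pos_def_sqrt_exists:
  fixes M :: "real^'n^'n"
  assumes M: "sym_pos_def M"
  obtains R where "sym_pos_def R" "R ** R = M"
proof -
  obtain B where B: "finite B" "span B = UNIV" "pairwise orthogonal B" "\<And>b. b \<in> B \<Longrightarrow> norm b = 1"
    "\<And>b. b \<in> B \<Longrightarrow> M *v b = (b \<bullet> (M *v b)) *\<^sub>R b"
    using symmetric_matrix_eigenbasis M unfolding sym_pos_def_def by blast
  define r where "r b = sqrt (b \<bullet> (M *v b))" for b
  have nz: "b \<noteq> 0" if "b \<in> B" for b using B(4)[OF that] by auto
  have r: "r b > 0" "M *v b = (r b * r b) *\<^sub>R b" if b: "b \<in> B" for b
  proof -
    have "b \<bullet> (M *v b) > 0" using M nz[OF b] by (simp add: sym_pos_def_def)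
    then show "r b > 0" "M *v b = (r b * r b) *\<^sub>R b" using B(5)[OF b] by (simp_all add: r_def)
  qed
  define f where "f x = (\<Sum>b\<in>B. (r b * (b \<bullet> x)) *\<^sub>R b)" for x
  have lin: "linear f"
    by (rule linearI) (simp_all add: f_def inner_simps algebra_simps sum.distrib scaleR_sum_right)
  have fb: "b \<bullet> f x = r b * (b \<bullet> x)" if b: "b \<in> B" for b x
  proof -
    have "b \<bullet> f x = (\<Sum>c\<in>B. r c * (c \<bullet> x) * (b \<bullet> c))" by (simp add: f_def inner_sum_right)
    also have "\<dots> = (\<Sum>c\<in>B. if c = b then r b * (b \<bullet> x) else 0)"
      using B b by (intro sum.cong) (auto simp: pairwise_def orthogonal_def dot_square_norm)
    finally show ?thesis using b B(1) by simp
  qed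
  define R where "R = matrix f"
  have Rf: "R *v x = f x" for x unfolding R_def using lin by (simp add: matrix_works linear_matrix_vector_mul_eq)
  \<comment> \<open>Both symmetry and positivity of \<open>R\<close> are read off this expression:
    it is symmetric in \<open>x\<close> and \<open>y\<close>, and for \<open>x = y\<close> it is a
    weighted sum of squares.\<close>
  have inner_f: "x \<bullet> f y = (\<Sum>b\<in>B. r b * (b \<bullet> x) * (b \<bullet> y))" for x y
    by (simp add: f_def inner_sum_right algebra_simps inner_commute)
  have "(transpose R *v x) \<bullet> y = (R *v x) \<bullet> y" for x y
    unfolding inner_matrix_vector_mult[symmetric] Rf inner_commute[of "f x"] inner_f
    by (simp add: mult_ac)
  then have "transpose R = R" by (metis matrix_eq vector_eq_rdot)
  moreover have "x \<bullet> (R *v x) > 0" if "x \<noteq> 0" for x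
  proof -
    have "\<exists>b\<in>B. b \<bullet> x \<noteq> 0"
    proof (rule ccontr)
      assume "\<not> ?thesis"
      then have "(\<Sum>b\<in>B. (b \<bullet> x) *\<^sub>R b) = 0" by (intro sum.neutral) auto
      then show False using orthonormal_expansion[OF B(1-4)] that by simp
    qed
    then obtain b where b: "b \<in> B" "b \<bullet> x \<noteq> 0" by blast
    then have "0 < r b * (b \<bullet> x) * (b \<bullet> x)" using r(1) by (simp add: mult.assoc zero_less_mult_iff) argo
    then show ?thesis unfolding Rf inner_f
      by (intro sum_pos2[OF B(1) b(1)]) (auto simp: mult.assoc less_imp_le[OF r(1)])
  qed
  moreover have "R ** R = M"
  proof -
    have "(R ** R) *v x = M *v x" for x
    proof -
      have "M *v x = M *v (\<Sum>b\<in>B. (b \<bullet> x) *\<^sub>R b)" using orthonormal_expansion[OF B(1-4)] by simp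
      also have "\<dots> = (\<Sum>b\<in>B. (b \<bullet> x) *\<^sub>R (M *v b))"
        by (simp add: linear_sum[OF matrix_vector_mul_linear] matrix_vector_mult_scaleR)
      also have "\<dots> = f (f x)" unfolding f_def[of "f x"]
        by (intro sum.cong) (simp_all add: fb r(2) algebra_simps)
      finally show ?thesis by (simp add: matrix_vector_mul_assoc[symmetric] Rf)
    qed
    then show ?thesis by (simp add: matrix_eq)
  qed
  ultimately show thesis using that[of R] by (simp add: sym_pos_def_def)
qed

text \<open>Existence and uniqueness of the root give meaning to the \<open>THE\<close> in its
  definition.\<close>

lemma spd_sqrt:
  fixes M :: "real^'n^'n"
  assumes "sym_pos_def M"
  shows "sym_pos_def (spd_sqrt M)" "spd_sqrt M ** spd_sqrt M = M"
proof -
  have "\<exists>!R. sym_pos_def R \<and> R ** R = M"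
    using sym_pos_def_sqrt_exists[OF assms] sym_pos_def_sqrt_unique by metis
  from theI'[OF this] show "sym_pos_def (spd_sqrt M)" "spd_sqrt M ** spd_sqrt M = M"
    unfolding spd_sqrt_def by blast+
qed

lemma sym_pos_def_invertible: "sym_pos_def M \<Longrightarrow> invertible M"
  unfolding sym_pos_def_def invertible_left_inverse matrix_left_invertible_ker
  by (metis inner_zero_right less_irrefl)

lemma invertible_matrix_inv:
  assumes "invertible M"
  shows "M ** matrix_inv M = mat 1" "matrix_inv M ** M = mat 1"
proof -
  have "M ** matrix_inv M = mat 1 \<and> matrix_inv M ** M = mat 1"
    unfolding matrix_inv_def by (rule someI_ex) (use assms in \<open>simp add: invertible_def\<close>)
  then show "M ** matrix_inv M = mat 1" "matrix_inv M ** M = mat 1" by blast+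
qed

section \<open>Powers of a matrix and its spectrum\<close>

text \<open>Once the perturbation is small, the bound \<open>r / 2\<close> reproduces itself under
  the recursion, and only a geometrically decaying excess over it remains.\<close>

lemma linear_recursion_tendsto_zero:
  fixes x e :: "nat \<Rightarrow> complex"
  assumes rec: "\<And>k. x (Suc k) = l * x k + e k" and l: "cmod l < 1" and e: "e \<longlonglongrightarrow> 0"
  shows "x \<longlonglongrightarrow> 0"
proof (rule LIMSEQ_I)
  fix r :: real assume r: "r > 0"
  define q where "q = cmod l"
  have q: "0 \<le> q" "q < 1" using l by (auto simp: q_def)
  \<comment> \<open>The threshold makes \<open>r / 2\<close> the fixed point of
    \<open>a \<mapsto> q * a + (1 - q) * (r / 2)\<close>.\<close>
  obtain N where N: "\<And>k. k \<ge> N \<Longrightarrow> cmod (e k) < (1 - q) * (r / 2)"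
    using LIMSEQ_D[OF e, of "(1 - q) * (r / 2)"] r q by auto
  have bound: "cmod (x (N + j)) \<le> q ^ j * cmod (x N) + r / 2" for j
  proof (induction j)
    case (Suc j)
    have "cmod (x (N + Suc j)) \<le> q * cmod (x (N + j)) + cmod (e (N + j))"
      using norm_triangle_ineq[of "l * x (N + j)" "e (N + j)"] by (simp add: rec norm_mult q_def)
    also have "\<dots> \<le> q * (q ^ j * cmod (x N) + r / 2) + (1 - q) * (r / 2)"
      using Suc.IH N[of "N + j"] q by (intro add_mono mult_left_mono) auto
    finally show ?case by (simp add: field_simps)
  qed (use r in simp)
  have "(\<lambda>j. q ^ j * cmod (x N)) \<longlonglongrightarrow> 0"
    using q by (intro tendsto_mult_left_zero LIMSEQ_realpow_zero) auto
  then obtain J where "\<forall>j\<ge>J. norm (q ^ j * cmod (x N) - 0) < r / 2"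
    using LIMSEQ_D r half_gt_zero by blast
  then have J: "q ^ j * cmod (x N) < r / 2" if "j \<ge> J" for j using that by fastforce
  have "norm (x n - 0) < r" if "n \<ge> N + J" for n
  proof -
    have "J \<le> n - N" using that by simp
    then show ?thesis using bound[of "n - N"] J[of "n - N"] that by simp
  qed
  then show "\<exists>no. \<forall>n\<ge>no. norm (x n - 0) < r" by blast
qed

section \<open>Polynomials in a matrix applied to a vector\<close>

lemma matrix_funpow_commute: "(((*v) T ^^ k) (T *v u)) = T *v (((*v) T ^^ k) u)"
  by (simp add: funpow_swap1)

lemma matrix_funpow_linear:
  fixes T :: "'a::field^'n^'n"
  shows "((*v) T ^^ k) (c *s u + v) = c *s (((*v) T ^^ k) u) + ((*v) T ^^ k) v"
  by (induction k) (simp_all add: matrix_vector_right_distrib vector_scalar_commute)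

text \<open>The value of \<open>p(T) u\<close>, for \<open>N \<ge> degree p\<close>.\<close>

definition poly_apply :: "nat \<Rightarrow> 'a::comm_ring_1^'n^'n \<Rightarrow> 'a poly \<Rightarrow> 'a^'n \<Rightarrow> 'a^'n" where
  "poly_apply N T p u = (\<Sum>i\<le>N. coeff p i *s (((*v) T ^^ i) u))"

text \<open>Since \<open>q(T)\<close> commutes with \<open>T - l\<close>, a linear factor can be
  moved onto the vector. Multiplication by \<open>X\<close> shifts the powers by one, hence
  \<open>Suc N\<close> on the left; the extra top coefficient of \<open>q\<close> vanishes.\<close>

lemma poly_apply_root_mult:
  fixes T :: "'a::field^'n^'n"
  assumes "degree q \<le> N"
  shows "poly_apply (Suc N) T ([:-l, 1:] * q) u = poly_apply N T q (T *v u - l *s u)"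
proof -
  have q: "coeff q (Suc N) = 0" using assms by (simp add: coeff_eq_0)
  have shift: "((*v) T ^^ i) (T *v u - l *s u) = ((*v) T ^^ Suc i) u - l *s ((*v) T ^^ i) u" for i
    using matrix_funpow_linear[where T = T and k = i and c = "-l" and u = u and v = "T *v u"]
    by (simp add: matrix_funpow_commute)
  have "poly_apply (Suc N) T ([:-l, 1:] * q) u
      = (\<Sum>i\<le>Suc N. coeff (pCons 0 q) i *s (((*v) T ^^ i) u)) - (\<Sum>i\<le>Suc N. (l * coeff q i) *s (((*v) T ^^ i) u))"
    by (simp add: poly_apply_def sum_subtractf[symmetric] vec.scale_left_diff_distrib del: sum.atMost_Suc)
  also have "(\<Sum>i\<le>Suc N. coeff (pCons 0 q) i *s (((*v) T ^^ i) u)) = (\<Sum>i\<le>N. coeff q i *s (((*v) T ^^ Suc i) u))"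
    by (subst sum.atMost_Suc_shift) simp
  also have "(\<Sum>i\<le>Suc N. (l * coeff q i) *s (((*v) T ^^ i) u)) = (\<Sum>i\<le>N. coeff q i *s (l *s (((*v) T ^^ i) u)))"
    using q by (simp add: mult.commute)
  finally show ?thesis
    by (simp add: poly_apply_def shift sum_subtractf[symmetric] vec.scale_right_diff_distrib del: funpow.simps)
qed

text \<open>Induction on the degree, with \<open>u\<close> generalised because removing a factor
  replaces \<open>u\<close> by \<open>T *v u - l *s u\<close>. A root of \<open>p\<close> may fail
  to be an eigenvalue of \<open>T\<close>, which forces the case distinction.\<close>

lemma funpow_tendsto_zero_if_annihilated:
  fixes T :: "complex^'n^'n"
  assumes eig: "\<And>l v. v \<noteq> 0 \<Longrightarrow> T *v v = l *s v \<Longrightarrow> cmod l < 1"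
    and "p \<noteq> 0" "degree p = N" "poly_apply N T p u = 0"
  shows "(\<lambda>k. ((*v) T ^^ k) u) \<longlonglongrightarrow> 0"
  using assms(2-)
proof (induction N arbitrary: p u)
  case 0
  then have "coeff p 0 \<noteq> 0" by (metis leading_coeff_0_iff)
  then have "u = 0" using 0 by (simp add: poly_apply_def)
  moreover have "((*v) T ^^ k) 0 = 0" for k by (induction k) simp_all
  ultimately show ?case by simp
next
  case (Suc N)
  obtain l where "poly p l = 0"
    using fundamental_theorem_of_algebra[of p] Suc.prems by (auto simp: constant_degree)
  then obtain q where p: "p = [:-l, 1:] * q" by (auto simp: poly_eq_0_iff_dvd elim: dvdE)
  have "q \<noteq> 0" using Suc.prems p by auto
  moreover from this have "degree p = Suc (degree q)" unfolding p by (subst degree_mult_eq) auto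
  ultimately have q: "q \<noteq> 0" "degree q = N" using Suc.prems by auto
  define w where "w = T *v u - l *s u"
  have "poly_apply N T q w = 0"
    using Suc.prems q poly_apply_root_mult[of q N T l u] by (simp add: p w_def)
  then have lim: "(\<lambda>k. ((*v) T ^^ k) w) \<longlonglongrightarrow> 0" using Suc.IH q by blast
  have shift: "((*v) T ^^ k) w = T *v (((*v) T ^^ k) u) - l *s ((*v) T ^^ k) u" for k
    using matrix_funpow_linear[where T = T and k = k and c = "-l" and u = u and v = "T *v u"]
    by (simp add: matrix_funpow_commute w_def)
  show ?case
  proof (cases "\<exists>v. v \<noteq> 0 \<and> T *v v = l *s v")
    \<comment> \<open>Each coordinate of the orbit of \<open>u\<close> satisfies
      \<open>x (Suc k) = l * x k + e k\<close>, where \<open>e\<close> is the coordinate of the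
      orbit of \<open>w\<close> and tends to zero by induction.\<close>
    case True
    then have l: "cmod l < 1" using eig by blast
    show ?thesis
    proof (rule vec_tendstoI)
      fix i
      have "(\<lambda>k. (((*v) T ^^ k) w) $ i) \<longlonglongrightarrow> 0" using tendsto_vec_nth[OF lim, of i] by simp
      moreover have "(((*v) T ^^ Suc k) u) $ i = l * ((((*v) T ^^ k) u) $ i) + (((*v) T ^^ k) w) $ i" for k
        by (simp add: shift)
      ultimately show "(\<lambda>k. (((*v) T ^^ k) u) $ i) \<longlonglongrightarrow> 0 $ i"
        using linear_recursion_tendsto_zero[of "\<lambda>k. (((*v) T ^^ k) u) $ i" l] l by simp
    qed
  next
    \<comment> \<open>Here \<open>T - mat l\<close> has a left inverse \<open>R\<close>, which
      recovers the orbit of \<open>u\<close> from that of \<open>w\<close>; continuity of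
      \<open>R\<close> transfers the limit.\<close>
    case False
    have mat: "mat l *v v = l *s v" for v :: "complex^'n"
      by (simp add: matrix_vector_mult_def mat_def vec_eq_iff if_distrib if_distribR cong: if_cong)
    have "v = 0" if "(T - mat l) *v v = 0" for v
      using False that by (auto simp: matrix_vector_mult_diff_rdistrib mat)
    then obtain R where R: "R ** (T - mat l) = mat 1" by (metis matrix_left_invertible_ker)
    have "((*v) T ^^ k) u = R *v (((*v) T ^^ k) w)" for k
    proof -
      have "((*v) T ^^ k) w = (T - mat l) *v (((*v) T ^^ k) u)"
        by (simp add: shift matrix_vector_mult_diff_rdistrib mat)
      then show ?thesis by (simp add: matrix_vector_mul_assoc R)
    qed
    moreover have "(\<lambda>k. R *v (((*v) T ^^ k) w)) \<longlonglongrightarrow> R *v 0"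
      using lim by (intro isCont_tendsto_compose[OF matrix_vector_mult_linear_continuous_at])
    ultimately show ?thesis by simp
  qed
qed

text \<open>The family is indexed, so that repeated members are allowed: a repetition gives the
  relation with coefficients 1 and -1, while distinct members outnumber the dimension.\<close>

lemma linear_relation_exists:
  fixes x :: "nat \<Rightarrow> 'a::euclidean_space"
  obtains c :: "nat \<Rightarrow> real" where "\<exists>i\<le>DIM('a). c i \<noteq> 0" "(\<Sum>i\<le>DIM('a). c i *\<^sub>R x i) = 0"
proof (cases "inj_on x {..DIM('a)}")
  case True
  then have "card (x ` {..DIM('a)}) > DIM('a)" by (simp add: card_image)
  then have "dependent (x ` {..DIM('a)})" using independent_bound by fastforce
  then obtain u where u: "\<exists>v\<in>x ` {..DIM('a)}. u v \<noteq> 0" "(\<Sum>v\<in>x ` {..DIM('a)}. u v *\<^sub>R v) = 0"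
    by (auto simp: dependent_finite)
  show thesis
    by (rule that[of "u \<circ> x"]) (use u True in \<open>auto simp: sum.reindex\<close>)
next
  case False
  then obtain i j where ij: "i \<le> DIM('a)" "j \<le> DIM('a)" "i \<noteq> j" "x i = x j"
    by (auto simp: inj_on_def)
  define c where "c k = (if k = i then 1 else 0) - (if k = j then 1 else 0::real)" for k
  have "(\<Sum>k\<le>DIM('a). c k *\<^sub>R x k) = 0"
    using ij by (simp add: c_def algebra_simps sum_subtractf if_distrib[of "\<lambda>t. t *\<^sub>R _"] cong: if_cong)
  moreover have "c i \<noteq> 0" using ij by (simp add: c_def)
  ultimately show thesis using that[of c] ij by blast
qed

text \<open>With \<open>N\<close> the real dimension of the space, the vectors
  \<open>u, T u, ..., T^N u\<close> satisfy a nontrivial real relation, whose coefficients are those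
  of \<open>p\<close>.\<close>

lemma annihilating_polynomial:
  fixes T :: "complex^'n^'n"
  obtains p where "p \<noteq> 0" "poly_apply (degree p) T p u = 0"
proof -
  define N where "N = DIM(complex^'n)"
  obtain c where c: "\<exists>i\<le>N. c i \<noteq> 0" "(\<Sum>i\<le>N. c i *\<^sub>R ((*v) T ^^ i) u) = 0"
    unfolding N_def by (rule linear_relation_exists[of "\<lambda>i. ((*v) T ^^ i) u"])
  define p where "p = (\<Sum>i\<le>N. monom (complex_of_real (c i)) i)"
  have coeff: "coeff p i = (if i \<le> N then of_real (c i) else 0)" for i
    by (simp add: p_def coeff_sum)
  have "degree p \<le> N" by (rule degree_le) (simp add: coeff)
  then have "poly_apply (degree p) T p u = poly_apply N T p u"
    unfolding poly_apply_def by (intro sum.mono_neutral_left) (auto simp: coeff_eq_0)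
  also have "\<dots> = 0"
  proof -
    have "complex_of_real t *s v = t *\<^sub>R v" for t and v :: "complex^'n"
      by (rule vec_eq_iff[THEN iffD2], rule allI, subst vector_scaleR_component)
        (simp add: scaleR_conv_of_real)
    then show ?thesis using c(2) by (simp add: poly_apply_def coeff)
  qed
  finally have "poly_apply (degree p) T p u = 0" .
  moreover have "p \<noteq> 0" using c(1) coeff by (metis coeff_0 of_real_eq_0_iff)
  ultimately show thesis using that by blast
qed

lemma funpow_tendsto_zero_complex:
  fixes T :: "complex^'n^'n"
  assumes "\<And>l v. v \<noteq> 0 \<Longrightarrow> T *v v = l *s v \<Longrightarrow> cmod l < 1"
  shows "(\<lambda>k. ((*v) T ^^ k) u) \<longlonglongrightarrow> 0"
proof -
  obtain p where p: "p \<noteq> 0" "poly_apply (degree p) T p u = 0" by (rule annihilating_polynomial)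
  show ?thesis by (rule funpow_tendsto_zero_if_annihilated[OF assms p(1) refl p(2)])
qed

section \<open>Real matrices acting on complex vectors\<close>

abbreviation complexify :: "real^'n^'m \<Rightarrow> complex^'n^'m" where
  "complexify \<equiv> map_matrix complex_of_real"

definition Re_vec :: "complex^'n \<Rightarrow> real^'n" where "Re_vec v = (\<chi> i. Re (v $ i))"
definition Im_vec :: "complex^'n \<Rightarrow> real^'n" where "Im_vec v = (\<chi> i. Im (v $ i))"

lemma Re_vec_complexify: "Re_vec (complexify M *v v) = M *v Re_vec v"
  by (simp add: Re_vec_def matrix_vector_mult_def vec_eq_iff)

lemma Im_vec_complexify: "Im_vec (complexify M *v v) = M *v Im_vec v"
  by (simp add: Im_vec_def matrix_vector_mult_def vec_eq_iff)

lemma Re_vec_funpow: "Re_vec (((*v) (complexify M) ^^ k) v) = ((*v) M ^^ k) (Re_vec v)"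
  for M :: "real^'n^'n"
  by (induction k) (simp_all add: Re_vec_complexify)

lemma Im_vec_funpow: "Im_vec (((*v) (complexify M) ^^ k) v) = ((*v) M ^^ k) (Im_vec v)"
  for M :: "real^'n^'n"
  by (induction k) (simp_all add: Im_vec_complexify)

lemma complexify_mult: "complexify (M ** N) = complexify M ** complexify N"
  by (simp add: matrix_matrix_mult_def vec_eq_iff)

lemma complexify_mat: "complexify (mat c) = mat (complex_of_real c)"
  by (simp add: mat_def vec_eq_iff)

text \<open>Eigenvectors are complex but the orbits are real. The real and imaginary parts of a
  complex orbit are real orbits, so for an eigenvector they force \<open>l ^ k\<close> to zero;
  conversely a real orbit is the real part of a complex one.\<close>

lemma powers_tendsto_zero_iff_spectrum:
  fixes T :: "real^'n^'n"
  shows "(\<forall>u. (\<lambda>k. ((*v) T ^^ k) u) \<longlonglongrightarrow> 0) \<longleftrightarrow> (\<forall>l\<in>spectrum T. cmod l < 1)"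
proof (intro iffI allI ballI)
  fix l assume lim: "\<forall>u. (\<lambda>k. ((*v) T ^^ k) u) \<longlonglongrightarrow> 0" and "l \<in> spectrum T"
  then obtain v where v: "v \<noteq> 0" "complexify T *v v = l *s v" by (auto simp: spectrum_def)
  then obtain i where i: "v $ i \<noteq> 0" by (auto simp: vec_eq_iff)
  have pow: "((*v) (complexify T) ^^ k) v = l ^ k *s v" for k
    by (induction k) (simp_all add: v(2) vec.scale vector_scalar_commute mult.commute)
  have comp: "l ^ k * v $ i = Complex ((((*v) T ^^ k) (Re_vec v)) $ i) ((((*v) T ^^ k) (Im_vec v)) $ i)" for k
    unfolding Re_vec_funpow[symmetric] Im_vec_funpow[symmetric] pow
    by (simp add: Re_vec_def Im_vec_def complex_eq_iff)
  have "(\<lambda>k. l ^ k * v $ i) \<longlonglongrightarrow> Complex ((0::real^'n) $ i) ((0::real^'n) $ i)"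
    unfolding comp using lim by (intro tendsto_Complex tendsto_vec_nth) auto
  then have "(\<lambda>k. l ^ k * v $ i / v $ i) \<longlonglongrightarrow> Complex 0 0 / v $ i"
    using i by (intro tendsto_divide tendsto_const) auto
  then have "(\<lambda>k. l ^ k) \<longlonglongrightarrow> 0" using i by (simp add: zero_complex.code[symmetric])
  then have "(\<lambda>k. cmod l ^ k) \<longlonglongrightarrow> 0"
    using tendsto_norm_zero[of "\<lambda>k. l ^ k"] by (simp add: norm_power)
  moreover have "1 \<le> cmod l ^ k" if "1 \<le> cmod l" for k using that by (rule one_le_power)
  ultimately have "\<not> 1 \<le> cmod l" by (meson LIMSEQ_le_const not_one_le_zero)
  then show "cmod l < 1" by simp
next
  fix u assume "\<forall>l\<in>spectrum T. cmod l < 1"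
  then have lim: "(\<lambda>k. ((*v) (complexify T) ^^ k) (\<chi> i. of_real (u $ i))) \<longlonglongrightarrow> 0"
    by (intro funpow_tendsto_zero_complex) (auto simp: spectrum_def)
  have Re: "((*v) T ^^ k) u = Re_vec (((*v) (complexify T) ^^ k) (\<chi> i. of_real (u $ i)))" for k
    unfolding Re_vec_funpow by (simp add: Re_vec_def)
  show "(\<lambda>k. ((*v) T ^^ k) u) \<longlonglongrightarrow> 0"
  proof (rule vec_tendstoI)
    fix i
    show "(\<lambda>k. (((*v) T ^^ k) u) $ i) \<longlonglongrightarrow> 0 $ i"
      unfolding Re using tendsto_Re[OF tendsto_vec_nth[OF lim, of i]] by (simp add: Re_vec_def)
  qed
qed

section \<open>The iteration for a general splitting\<close>

text \<open>Since \<open>\<A> = P - Q\<close>, the solution \<open>u\<close> is a fixed point of the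
  iteration, and subtracting it removes the constant term.\<close>

lemma PESS_error:
  assumes P: "invertible (P_PESS \<Sigma> \<A> s)" and u: "\<A> *v u = d"
  shows "PESS_iter \<Sigma> \<A> s d u0 k = u + ((*v) (T_PESS \<Sigma> \<A> s) ^^ k) (u0 - u)"
proof (induction k)
  case (Suc k)
  define P where "P = P_PESS \<Sigma> \<A> s"
  define Q where "Q = Q_PESS \<Sigma> \<A> s"
  have "P - Q = \<A>" by (simp add: P_def Q_def P_PESS_def Q_PESS_def algebra_simps)
  then have "P *v u = Q *v u + d"
    using u by (metis diff_eq_eq add.commute matrix_vector_mult_diff_rdistrib)
  then have "matrix_inv P *v (P *v u) = matrix_inv P *v (Q *v u) + matrix_inv P *v d"
    by (simp add: matrix_vector_right_distrib)
  moreover have "matrix_inv P ** P = mat 1"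
    using P by (simp add: P_def invertible_matrix_inv)
  ultimately have "u = T_PESS \<Sigma> \<A> s *v u + c_PESS \<Sigma> \<A> s d"
    by (simp add: matrix_vector_mul_assoc T_PESS_def c_PESS_def P_def Q_def)
  then show ?case using Suc.IH
    by (simp add: matrix_vector_right_distrib matrix_vector_mult_diff_distrib add_ac)
qed simp

section \<open>Spectra of the preconditioned matrix and of the iteration matrix\<close>

lemma complexify_linear_combination:
  "complexify (a *\<^sub>R M + b *\<^sub>R N) *v v = of_real a *s (complexify M *v v) + of_real b *s (complexify N *v v)"
  by (simp add: matrix_vector_mult_def vec_eq_iff sum_distrib_left algebra_simps sum.distrib)

lemma complexify_invertible_ker:
  assumes "invertible M" "complexify M *v v = 0"
  shows "v = 0"
proof -
  have "complexify (matrix_inv M) ** complexify M = mat 1"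
    using assms(1) by (simp add: complexify_mult[symmetric] invertible_matrix_inv complexify_mat)
  then have "v = complexify (matrix_inv M) *v (complexify M *v v)"
    by (simp add: matrix_vector_mul_assoc)
  then show ?thesis using assms(2) by simp
qed

text \<open>The substitution \<open>w = R *v v\<close>, with \<open>R\<close> the inverse square
  root of \<open>\<Sigma>\<close>, turns the eigenvalue equation into the pencil. It is invertible,
  so nonzero vectors stay nonzero.\<close>

lemma spectrum_preconditioned:
  fixes \<Sigma> \<A> :: "real^'k^'k"
  assumes "sym_pos_def \<Sigma>"
  shows "spectrum (spd_inv_sqrt \<Sigma> ** \<A> ** spd_inv_sqrt \<Sigma>)
    = {\<mu>. \<exists>w. w \<noteq> 0 \<and> complexify \<A> *v w = \<mu> *s (complexify \<Sigma> *v w)}"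
proof -
  define S where "S = complexify (spd_sqrt \<Sigma>)"
  define R where "R = complexify (spd_inv_sqrt \<Sigma>)"
  have inv: "invertible (spd_sqrt \<Sigma>)" using assms spd_sqrt(1) sym_pos_def_invertible by blast
  have SR: "S ** R = mat 1" "R ** S = mat 1"
    using inv by (simp_all add: S_def R_def spd_inv_sqrt_def complexify_mult[symmetric] invertible_matrix_inv complexify_mat)
  have SS: "complexify \<Sigma> = S ** S"
    using spd_sqrt(2)[OF assms] by (simp add: S_def complexify_mult[symmetric])
  have SRv: "S *v (R *v v) = v" "R *v (S *v v) = v" for v
    by (simp_all add: matrix_vector_mul_assoc SR)
  have eq: "complexify (spd_inv_sqrt \<Sigma> ** \<A> ** spd_inv_sqrt \<Sigma>) *v v = R *v (complexify \<A> *v (R *v v))" for v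
    by (simp add: complexify_mult R_def matrix_vector_mul_assoc matrix_mul_assoc)
  show ?thesis
  proof (intro set_eqI iffI; clarsimp simp: spectrum_def eq)
    fix \<mu> and v :: "complex^'k" assume v: "v \<noteq> 0" "R *v (complexify \<A> *v (R *v v)) = \<mu> *s v"
    then have "S *v (R *v (complexify \<A> *v (R *v v))) = \<mu> *s (S *v (S *v (R *v v)))"
      by (simp add: SRv vector_scalar_commute)
    then have "complexify \<A> *v (R *v v) = \<mu> *s (complexify \<Sigma> *v (R *v v))"
      by (simp only: SRv SS matrix_vector_mul_assoc[symmetric])
    moreover have "R *v v \<noteq> 0" using v(1) SRv by (metis matrix_vector_mult_0_right)
    ultimately show "\<exists>w. w \<noteq> 0 \<and> complexify \<A> *v w = \<mu> *s (complexify \<Sigma> *v w)" by blast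
  next
    fix \<mu> and w :: "complex^'k" assume w: "w \<noteq> 0" "complexify \<A> *v w = \<mu> *s (complexify \<Sigma> *v w)"
    have "R *v (complexify \<A> *v (R *v (S *v w))) = \<mu> *s (R *v (S *v (S *v w)))"
      by (simp add: SRv w(2) SS matrix_vector_mul_assoc[symmetric] vector_scalar_commute)
    then have "R *v (complexify \<A> *v (R *v (S *v w))) = \<mu> *s (S *v w)" by (simp only: SRv)
    moreover have "S *v w \<noteq> 0" using w(1) SRv by (metis matrix_vector_mult_0_right)
    ultimately show "\<exists>v. v \<noteq> 0 \<and> R *v (complexify \<A> *v (R *v v)) = \<mu> *s v" by blast
  qed
qed

text \<open>Multiplying by \<open>P\<close> turns the eigenvalue equation into
  \<open>Q w = l P w\<close>, and the terms in \<open>\<Sigma>\<close> and \<open>\<A>\<close> are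
  then collected. No division takes place, so no factor has to be nonzero yet.\<close>

lemma spectrum_T_PESS:
  fixes \<Sigma> \<A> :: "real^'k^'k"
  assumes P: "invertible (P_PESS \<Sigma> \<A> s)"
  shows "spectrum (T_PESS \<Sigma> \<A> s) = {l. \<exists>w. w \<noteq> 0 \<and>
    (1 - l) *s (complexify \<Sigma> *v w) = (1 - of_real s + l * of_real s) *s (complexify \<A> *v w)}"
proof -
  define P where "P = complexify (P_PESS \<Sigma> \<A> s)"
  define Q where "Q = complexify (Q_PESS \<Sigma> \<A> s)"
  define I where "I = complexify (matrix_inv (P_PESS \<Sigma> \<A> s))"
  have IP: "I ** P = mat 1" "P ** I = mat 1"
    using P by (simp_all add: I_def P_def complexify_mult[symmetric] invertible_matrix_inv complexify_mat)
  have "complexify (T_PESS \<Sigma> \<A> s) *v w = l *s w \<longleftrightarrow> Q *v w = l *s (P *v w)" for l w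
  proof
    assume "complexify (T_PESS \<Sigma> \<A> s) *v w = l *s w"
    then have "P *v (I *v (Q *v w)) = P *v (l *s w)"
      by (simp add: T_PESS_def complexify_mult I_def Q_def matrix_vector_mul_assoc)
    then show "Q *v w = l *s (P *v w)" by (simp add: matrix_vector_mul_assoc IP matrix_mul_assoc vector_scalar_commute)
  next
    assume "Q *v w = l *s (P *v w)"
    then have "I *v (Q *v w) = l *s (I *v (P *v w))" by (simp add: vector_scalar_commute)
    then show "complexify (T_PESS \<Sigma> \<A> s) *v w = l *s w"
      using IP by (simp add: T_PESS_def complexify_mult I_def Q_def matrix_vector_mul_assoc)
  qed
  moreover have "Q *v w = l *s (P *v w) \<longleftrightarrow>
      (1 - l) *s (complexify \<Sigma> *v w) = (1 - of_real s + l * of_real s) *s (complexify \<A> *v w)" for l w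
  proof -
    have "Q *v w = complexify \<Sigma> *v w - (1 - of_real s) *s (complexify \<A> *v w)"
    proof -
      have "Q = complexify (1 *\<^sub>R \<Sigma> + (-(1 - s)) *\<^sub>R \<A>)"
        unfolding Q_def Q_PESS_def scaleR_minus_left by simp
      then show ?thesis by (simp only: complexify_linear_combination) simp
    qed
    moreover have "P *v w = complexify \<Sigma> *v w + of_real s *s (complexify \<A> *v w)"
      using complexify_linear_combination[of 1 \<Sigma> s \<A> w] by (simp add: P_def P_PESS_def)
    ultimately show ?thesis by (simp only: vec_eq_iff) (simp add: algebra_simps)
  qed
  ultimately show ?thesis by (simp add: spectrum_def)
qed

text \<open>In the difference of the squares the coefficient of \<open>(cmod \<mu>)\<^sup>2\<close>
  is \<open>s\<^sup>2 - (1 - s)\<^sup>2 = 2 * s - 1\<close>.\<close>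

lemma cmod_square_less_iff:
  fixes \<mu> :: complex and s :: real
  shows "(cmod (1 - (1 - of_real s) * \<mu>))\<^sup>2 < (cmod (1 + of_real s * \<mu>))\<^sup>2
    \<longleftrightarrow> (2 * s - 1) * (cmod \<mu>)\<^sup>2 + 2 * Re \<mu> > 0"
  unfolding cmod_power2 by (simp add: power2_eq_square) (simp add: algebra_simps)

text \<open>The Moebius map \<open>l = (1 - (1 - s) \<mu>) / (1 + s \<mu>)\<close> and its inverse
  \<open>\<mu> = (1 - l) / (1 - s + l s)\<close> match the two spectra; the work lies in showing
  that neither denominator vanishes.\<close>

lemma spectrum_T_PESS_iff:
  fixes \<Sigma> \<A> :: "real^'k^'k"
  assumes \<Sigma>: "sym_pos_def \<Sigma>" and P: "invertible (P_PESS \<Sigma> \<A> s)"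
  shows "(\<forall>l\<in>spectrum (T_PESS \<Sigma> \<A> s). cmod l < 1) \<longleftrightarrow>
    (\<forall>\<mu>\<in>spectrum (spd_inv_sqrt \<Sigma> ** \<A> ** spd_inv_sqrt \<Sigma>). (2 * s - 1) * (cmod \<mu>)\<^sup>2 + 2 * Re \<mu> > 0)"
    (is "?L \<longleftrightarrow> ?R")
proof
  \<comment> \<open>If \<open>1 + s \<mu>\<close> were zero, \<open>w\<close> would lie in the
    kernel of the invertible \<open>P\<close>.\<close>
  have P0: "1 + of_real s * \<mu> \<noteq> 0"
    if "w \<noteq> 0" "complexify \<A> *v w = \<mu> *s (complexify \<Sigma> *v w)" for \<mu> w
  proof
    assume "1 + of_real s * \<mu> = 0"
    moreover have "complexify (P_PESS \<Sigma> \<A> s) *v w = (1 + of_real s * \<mu>) *s (complexify \<Sigma> *v w)"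
      using complexify_linear_combination[of 1 \<Sigma> s \<A> w] that(2)
      by (simp add: P_PESS_def vec_eq_iff algebra_simps)
    ultimately show False using complexify_invertible_ker[OF P, of w] that(1) by simp
  qed
  have less1: "cmod l < 1 \<longleftrightarrow> (2 * s - 1) * (cmod \<mu>)\<^sup>2 + 2 * Re \<mu> > 0"
    if "1 - (1 - of_real s) * \<mu> = l * (1 + of_real s * \<mu>)" "1 + of_real s * \<mu> \<noteq> 0" for l \<mu>
  proof -
    have "l = (1 - (1 - of_real s) * \<mu>) / (1 + of_real s * \<mu>)" using that by (simp add: nonzero_eq_divide_eq)
    then have "cmod l < 1 \<longleftrightarrow> cmod (1 - (1 - of_real s) * \<mu>) < cmod (1 + of_real s * \<mu>)"
      using that(2) by (simp add: norm_divide divide_less_eq)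
    also have "\<dots> \<longleftrightarrow> (cmod (1 - (1 - of_real s) * \<mu>))\<^sup>2 < (cmod (1 + of_real s * \<mu>))\<^sup>2"
      by (metis norm_ge_zero power2_less_imp_less power_strict_mono zero_less_numeral)
    finally show ?thesis unfolding cmod_square_less_iff .
  qed
  show ?R if L: ?L
  proof
    fix \<mu> assume "\<mu> \<in> spectrum (spd_inv_sqrt \<Sigma> ** \<A> ** spd_inv_sqrt \<Sigma>)"
    then obtain w where w: "w \<noteq> 0" "complexify \<A> *v w = \<mu> *s (complexify \<Sigma> *v w)"
      using spectrum_preconditioned[OF \<Sigma>] by auto
    define l where "l = (1 - (1 - of_real s) * \<mu>) / (1 + of_real s * \<mu>)"
    have l: "1 - (1 - of_real s) * \<mu> = l * (1 + of_real s * \<mu>)" using P0[OF w] by (simp add: l_def)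
    then have "1 - l = (1 - of_real s + l * of_real s) * \<mu>" by algebra
    then have "(1 - l) *s (complexify \<Sigma> *v w) = (1 - of_real s + l * of_real s) *s (complexify \<A> *v w)"
      unfolding w(2) by simp
    then have "l \<in> spectrum (T_PESS \<Sigma> \<A> s)" using w(1) spectrum_T_PESS[OF P] by auto
    then show "(2 * s - 1) * (cmod \<mu>)\<^sup>2 + 2 * Re \<mu> > 0" using less1[OF l P0[OF w]] L by blast
  qed
  show ?L if R: ?R
  proof
    fix l assume "l \<in> spectrum (T_PESS \<Sigma> \<A> s)"
    then obtain w where w: "w \<noteq> 0"
      "(1 - l) *s (complexify \<Sigma> *v w) = (1 - of_real s + l * of_real s) *s (complexify \<A> *v w)"
      using spectrum_T_PESS[OF P] by auto
    define c where "c = 1 - of_real s + l * of_real s"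
    \<comment> \<open>If \<open>c = 0\<close>, invertibility of \<open>\<Sigma>\<close> forces
      \<open>l = 1\<close>, and then \<open>c = 1\<close>.\<close>
    have "c \<noteq> 0"
    proof
      assume c: "c = 0"
      then have "(1 - l) *s (complexify \<Sigma> *v w) = 0" using w(2) by (simp add: c_def)
      moreover have "complexify \<Sigma> *v w \<noteq> 0"
        using complexify_invertible_ker[OF sym_pos_def_invertible[OF \<Sigma>]] w(1) by blast
      ultimately have "1 - l = 0" by (metis vector_mul_eq_0)
      then show False using c by (simp add: c_def)
    qed
    define \<mu> where "\<mu> = (1 - l) / c"
    have \<mu>: "\<mu> * c = 1 - l" using \<open>c \<noteq> 0\<close> by (simp add: \<mu>_def)
    have "c *s (complexify \<A> *v w) = c *s (\<mu> *s (complexify \<Sigma> *v w))"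
      using w(2) by (simp add: c_def[symmetric] \<mu> mult.commute)
    then have ev: "complexify \<A> *v w = \<mu> *s (complexify \<Sigma> *v w)" using \<open>c \<noteq> 0\<close> by (simp add: vec.scale_left_imp_eq)
    then have "\<mu> \<in> spectrum (spd_inv_sqrt \<Sigma> ** \<A> ** spd_inv_sqrt \<Sigma>)"
      using spectrum_preconditioned[OF \<Sigma>] w(1) by auto
    moreover have "1 - (1 - of_real s) * \<mu> = l * (1 + of_real s * \<mu>)"
      using \<mu> unfolding c_def by algebra
    ultimately show "cmod l < 1" using less1 P0[OF w(1) ev] R by blast
  qed
qed

lemma PESS_converges_iff:
  fixes \<Sigma> \<A> :: "real^'k^'k"
  assumes \<Sigma>: "sym_pos_def \<Sigma>" and P: "invertible (P_PESS \<Sigma> \<A> s)" and u: "\<A> *v u = d"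
  shows "(\<forall>u0. PESS_iter \<Sigma> \<A> s d u0 \<longlonglongrightarrow> u) \<longleftrightarrow>
    (\<forall>\<mu>\<in>spectrum (spd_inv_sqrt \<Sigma> ** \<A> ** spd_inv_sqrt \<Sigma>). (2 * s - 1) * (cmod \<mu>)\<^sup>2 + 2 * Re \<mu> > 0)"
proof -
  let ?T = "T_PESS \<Sigma> \<A> s"
  have "PESS_iter \<Sigma> \<A> s d u0 \<longlonglongrightarrow> u \<longleftrightarrow> (\<lambda>k. ((*v) ?T ^^ k) (u0 - u)) \<longlonglongrightarrow> 0" for u0
    by (subst Lim_null) (simp add: PESS_error[OF P u])
  \<comment> \<open>As \<open>u0\<close> runs through all starting vectors, so does the initial
    error \<open>u0 - u\<close>.\<close>
  then have "(\<forall>u0. PESS_iter \<Sigma> \<A> s d u0 \<longlonglongrightarrow> u) \<longleftrightarrow> (\<forall>v. (\<lambda>k. ((*v) ?T ^^ k) v) \<longlonglongrightarrow> 0)"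
    by (metis add_diff_cancel_right')
  then show ?thesis
    using powers_tendsto_zero_iff_spectrum[of ?T] spectrum_T_PESS_iff[OF \<Sigma> P] by simp
qed

section \<open>The saddle point matrix\<close>

lemma sum_UNIV_sum3:
  fixes f :: "'n::finite + 'm::finite + 'p::finite \<Rightarrow> 'a::comm_monoid_add"
  shows "(\<Sum>i\<in>UNIV. f i) = (\<Sum>a\<in>UNIV. f (Inl a)) + (\<Sum>b\<in>UNIV. f (Inr (Inl b))) + (\<Sum>c\<in>UNIV. f (Inr (Inr c)))"
proof -
  have "(\<Sum>i\<in>UNIV. f i) = (\<Sum>a\<in>UNIV. f (Inl a)) + (\<Sum>j\<in>UNIV. f (Inr j))"
    by (simp add: UNIV_Plus_UNIV[symmetric] sum.Plus del: UNIV_Plus_UNIV)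
  also have "(\<Sum>j\<in>UNIV. f (Inr j)) = (\<Sum>b\<in>UNIV. f (Inr (Inl b))) + (\<Sum>c\<in>UNIV. f (Inr (Inr c)))"
    using sum.Plus[of UNIV UNIV "\<lambda>j. f (Inr j)"] by simp
  finally show ?thesis by (simp add: add.assoc)
qed

definition first_block :: "'a^('n::finite + 'm::finite + 'p::finite) \<Rightarrow> 'a^'n::finite" where "first_block x = (\<chi> i. x $ Inl i)"
definition second_block :: "'a^('n::finite + 'm::finite + 'p::finite) \<Rightarrow> 'a^'m::finite" where "second_block x = (\<chi> i. x $ Inr (Inl i))"
definition third_block :: "'a^('n::finite + 'm::finite + 'p::finite) \<Rightarrow> 'a^'p" where "third_block x = (\<chi> i. x $ Inr (Inr i))"

lemmas block_defs = first_block_def second_block_def third_block_def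

lemma blocks_eq_iff:
  "x = y \<longleftrightarrow> first_block x = first_block y \<and> second_block x = second_block y \<and> third_block x = third_block y"
proof -
  have "x $ k = y $ k" if "\<And>i. x $ Inl i = y $ Inl i" "\<And>i. x $ Inr (Inl i) = y $ Inr (Inl i)"
    "\<And>i. x $ Inr (Inr i) = y $ Inr (Inr i)" for k
    using that by (metis sum.exhaust_sel)
  then show ?thesis by (auto simp: block_defs vec_eq_iff)
qed

lemma block_zero [simp]: "first_block 0 = 0" "second_block 0 = 0" "third_block 0 = 0"
  by (simp_all add: block_defs vec_eq_iff)

lemma inner_blocks:
  fixes x y :: "real^('n::finite + 'm::finite + 'p::finite)"
  shows "x \<bullet> y = first_block x \<bullet> first_block y + second_block x \<bullet> second_block y + third_block x \<bullet> third_block y"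
  by (simp add: inner_vec_def sum_UNIV_sum3 block_defs)

lemma blocks_block3_mult:
  fixes x :: "real^('n::finite + 'm::finite + 'p::finite)"
  shows "first_block (block3 M11 M12 M13 M21 M22 M23 M31 M32 M33 *v x)
      = M11 *v first_block x + M12 *v second_block x + M13 *v third_block x"
    and "second_block (block3 M11 M12 M13 M21 M22 M23 M31 M32 M33 *v x)
      = M21 *v first_block x + M22 *v second_block x + M23 *v third_block x"
    and "third_block (block3 M11 M12 M13 M21 M22 M23 M31 M32 M33 *v x)
      = M31 *v first_block x + M32 *v second_block x + M33 *v third_block x"
  by (simp_all add: block_defs block3_def matrix_vector_mult_def vec_eq_iff sum_UNIV_sum3)

text \<open>The quadratic form splits into three nonnegative block forms, and a nonzero vector has a
  nonzero block.\<close>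

lemma sym_pos_def_Sigma_matrix:
  fixes \<Lambda>1 :: "real^'n^'n" and \<Lambda>2 :: "real^'m^'m" and \<Lambda>3 :: "real^'p^'p"
  assumes "sym_pos_def \<Lambda>1" "sym_pos_def \<Lambda>2" "sym_pos_def \<Lambda>3"
  shows "sym_pos_def (Sigma_matrix \<Lambda>1 \<Lambda>2 \<Lambda>3)"
proof -
  have sym: "\<Lambda>1 $ i $ j = \<Lambda>1 $ j $ i" "\<Lambda>2 $ k $ l = \<Lambda>2 $ l $ k" "\<Lambda>3 $ q $ r = \<Lambda>3 $ r $ q" for i j k l q r
    using assms unfolding sym_pos_def_def transpose_def by (metis vec_lambda_beta)+
  have "transpose (Sigma_matrix \<Lambda>1 \<Lambda>2 \<Lambda>3) = Sigma_matrix \<Lambda>1 \<Lambda>2 \<Lambda>3"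
    unfolding vec_eq_iff
    by (auto simp: Sigma_matrix_def block3_def transpose_def sym split: sum.splits)
  moreover have "x \<bullet> (Sigma_matrix \<Lambda>1 \<Lambda>2 \<Lambda>3 *v x) > 0" if "x \<noteq> 0" for x
  proof -
    have pos: "y \<bullet> (M *v y) \<ge> 0" "y \<noteq> 0 \<Longrightarrow> y \<bullet> (M *v y) > 0" if "sym_pos_def M" for M :: "real^'k^'k" and y
      using that by (cases "y = 0"; force simp: sym_pos_def_def)+
    have "x \<bullet> (Sigma_matrix \<Lambda>1 \<Lambda>2 \<Lambda>3 *v x) = first_block x \<bullet> (\<Lambda>1 *v first_block x)
        + second_block x \<bullet> (\<Lambda>2 *v second_block x) + third_block x \<bullet> (\<Lambda>3 *v third_block x)"
      by (simp add: inner_blocks Sigma_matrix_def blocks_block3_mult)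
    moreover have "first_block x \<noteq> 0 \<or> second_block x \<noteq> 0 \<or> third_block x \<noteq> 0"
      using that blocks_eq_iff[of x 0] by auto
    ultimately show ?thesis
      using pos[OF assms(1)] pos[OF assms(2)] pos[OF assms(3)]
      by (metis add_nonneg_pos add_pos_nonneg add_nonneg_nonneg)
  qed
  ultimately show ?thesis by (simp add: sym_pos_def_def)
qed

section \<open>Nonsingularity of the saddle point matrix and of the preconditioner\<close>

lemma uminus_matrix_vector_mult: "(- M) *v x = - (M *v x)" for M :: "real^'n^'m"
  by (simp add: matrix_vector_mult_def vec_eq_iff sum_negf)

text \<open>The off-diagonal blocks are skew-symmetric, so their contributions cancel in
  pairs.\<close>

lemma saddle_matrix_quadratic_form:
  "x \<bullet> (saddle_matrix A B C *v x) = first_block x \<bullet> (A *v first_block x)"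
proof -
  have "first_block x \<bullet> (transpose B *v second_block x) = second_block x \<bullet> (B *v first_block x)"
    "second_block x \<bullet> (transpose C *v third_block x) = third_block x \<bullet> (C *v second_block x)"
    using inner_matrix_vector_mult[of _ "transpose B"] inner_matrix_vector_mult[of _ "transpose C"]
    unfolding transpose_transpose by (simp_all only: inner_commute)
  then show ?thesis
    by (simp add: inner_blocks saddle_matrix_def blocks_block3_mult inner_simps
        uminus_matrix_vector_mult del: transpose_matrix_vector)
qed

text \<open>Full row rank of \<open>B\<close> is full column rank of its transpose, that is,
  injectivity.\<close>

lemma full_row_rank_transpose_ker:
  assumes "full_row_rank B" "transpose B *v y = 0"
  shows "y = 0"
proof -
  have "inj ((*v) (transpose B))"
    using assms(1) unfolding full_row_rank_def full_rank_injective[symmetric] rank_transpose .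
  then show ?thesis using assms(2) by (metis injD matrix_vector_mult_0_right)
qed

text \<open>For a kernel vector the quadratic form annihilates the first block. The first two block
  equations then reduce to \<open>transpose B\<close> and \<open>transpose C\<close> applied to the
  remaining blocks.\<close>

lemma saddle_matrix_invertible:
  assumes A: "sym_pos_def A" and B: "full_row_rank B" and C: "full_row_rank C"
  shows "invertible (saddle_matrix A B C)"
  unfolding invertible_left_inverse matrix_left_invertible_ker
proof (intro allI impI)
  fix x assume x: "saddle_matrix A B C *v x = 0"
  then have "first_block x \<bullet> (A *v first_block x) = 0" by (metis saddle_matrix_quadratic_form inner_zero_right)
  then have 1: "first_block x = 0" using A unfolding sym_pos_def_def by (metis less_irrefl)
  have "transpose B *v second_block x = 0" "transpose C *v third_block x = 0"
    using x 1 unfolding blocks_eq_iff saddle_matrix_def blocks_block3_mult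
    by (simp_all add: uminus_matrix_vector_mult del: transpose_matrix_vector)
  then show "x = 0" using 1 full_row_rank_transpose_ker[OF B] full_row_rank_transpose_ker[OF C]
    by (simp add: blocks_eq_iff[of x])
qed

text \<open>On a kernel vector the form of \<open>\<Sigma>\<close> plus a nonnegative term is zero,
  so positive definiteness leaves only the zero vector.\<close>

lemma P_PESS_invertible:
  assumes "sym_pos_def \<Sigma>" "\<And>x. x \<bullet> (\<A> *v x) \<ge> 0" "s \<ge> 0"
  shows "invertible (P_PESS \<Sigma> \<A> s)"
  unfolding invertible_left_inverse matrix_left_invertible_ker
proof (intro allI impI)
  fix x assume "P_PESS \<Sigma> \<A> s *v x = 0"
  then have "x \<bullet> (\<Sigma> *v x) + s * (x \<bullet> (\<A> *v x)) = 0"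
    by (metis P_PESS_def inner_add_right inner_scaleR_right inner_zero_right
        matrix_vector_mult_add_rdistrib scaleR_matrix_vector_assoc)
  moreover have "s * (x \<bullet> (\<A> *v x)) \<ge> 0" using assms by simp
  ultimately have "\<not> x \<bullet> (\<Sigma> *v x) > 0" by linarith
  then show "x = 0" using assms(1) unfolding sym_pos_def_def by blast
qed

theorem theorem3p1:
  fixes A \<Lambda>1 :: "real^'n^'n" and B :: "real^'n^'m" and C :: "real^'m^'p"
    and \<Lambda>2 :: "real^'m^'m" and \<Lambda>3 :: "real^'p^'p"
    and d :: "real^('n + 'm + 'p)" and s :: real
    and \<A> \<Sigma> :: "real^('n + 'm + 'p)^('n + 'm + 'p)"
  defines "\<A> \<equiv> saddle_matrix A B C"
    and "\<Sigma> \<equiv> Sigma_matrix \<Lambda>1 \<Lambda>2 \<Lambda>3"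
  assumes "sym_pos_def \<Lambda>1" and "sym_pos_def \<Lambda>2" and "sym_pos_def \<Lambda>3"
    and "sym_pos_def A" and "full_row_rank B" and "full_row_rank C" and "s > 0"
  shows "(\<exists>!u. \<A> *v u = d) \<and>
    ((\<forall>u0. PESS_iter \<Sigma> \<A> s d u0 \<longlonglongrightarrow> (THE u. \<A> *v u = d)) \<longleftrightarrow>
     (\<forall>\<mu> \<in> spectrum (spd_inv_sqrt \<Sigma> ** \<A> ** spd_inv_sqrt \<Sigma>).
        (2 * s - 1) * (cmod \<mu>)\<^sup>2 + 2 * Re \<mu> > 0))"
proof -
  have \<Sigma>: "sym_pos_def \<Sigma>" unfolding \<Sigma>_def using assms by (intro sym_pos_def_Sigma_matrix)
  have "x \<bullet> (\<A> *v x) \<ge> 0" for x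
    unfolding \<A>_def saddle_matrix_quadratic_form
    using \<open>sym_pos_def A\<close> unfolding sym_pos_def_def by (metis inner_zero_left less_imp_le order_refl)
  then have P: "invertible (P_PESS \<Sigma> \<A> s)" using \<Sigma> \<open>s > 0\<close> by (intro P_PESS_invertible) auto
  have "bij ((*v) \<A>)"
    unfolding \<A>_def invertible_eq_bij[symmetric] using assms by (intro saddle_matrix_invertible)
  then have ex1: "\<exists>!u. \<A> *v u = d" by (metis bij_pointE)
  \<comment> \<open>This makes the \<open>THE\<close> term an actual solution, so the convergence
    criterion for a given solution applies to it.\<close>
  then have "\<A> *v (THE u. \<A> *v u = d) = d" by (rule theI')
  then show ?thesis using ex1 PESS_converges_iff[OF \<Sigma> P] by blast
qed

end
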